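(* Let $u$ be a bounded solution of $\mathcal{L}u=0$ in $(0,\infty)\times\mathbb{S}^1$. Then \[ u(r,t)=\sum_{\mathrm{Re}(\sigma_j^\pm)=0}a_j^\pm w_j^\pm(r,t),\qquad a_j^\pm\in\mathbb{R}, \] (a finite sum over the basic solutions whose exponents lie on $i\mathbb{R}$). In particular, if $\mathcal{L}$ has no spectral values in $i\mathbb{R}$, then $u\equiv0$.
   Context: Fix $a>0$, $b\in\mathbb{R}\setminus\{0\}$, $\lambda=a+ib$, $\nu\in[0,1)$, an integer $k\ge2$ and $c\in C^k(\mathbb{S}^1,\mathbb{C})$. On $(0,\infty)\times\mathbb{S}^1$ (coordinates $(r,t)$) let $\mathcal{L}u=\lambda u_t-iru_r+i\lambda\nu u-c(t)\bar u$. A basic solution of $\mathcal{L}$ is a nontrivial solution of $\mathcal{L}w=0$ on $(0,\infty)\times\mathbb{S}^1$ of the form $w=r^\sigma\phi(t)+\overline{r^\sigma\psi(t)}$, $\sigma\in\mathbb{C}$, $\phi,\psi$ $2\pi$-periodic, written with $|\phi|>|\psi|$ when $\sigma\notin\mathbb{R}$ and as $r^\sigma f$ when $\sigma\in\mathbb{R}$; $\sigma$ is its exponent (a spectral value of $\mathcal{L}$) and the winding number of $\phi$ (resp. $f$) is its winding number. For each $j\in\mathbb{Z}$, $w_j^\pm$ denote the two $\mathbb{R}$-independent basic solutions with winding number $j$, with exponents $\sigma_j^\pm$; these exhaust the spectral values. *)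

theory Defs
  imports "HOL-Analysis.Analysis"
begin

definition vd :: "(real \<Rightarrow> complex) \<Rightarrow> real \<Rightarrow> complex" where
  "vd f = (\<lambda>x. vector_derivative f (at x))"

definition Ck :: "nat \<Rightarrow> (real \<Rightarrow> complex) \<Rightarrow> bool" where
  "Ck k f \<longleftrightarrow>
     (\<forall>j<k. \<forall>x. (((vd ^^ j) f) has_vector_derivative ((vd ^^ Suc j) f x)) (at x))
     \<and> continuous_on UNIV ((vd ^^ k) f)"

text \<open>Functions on (0,\<infinity>) \<times> S^1 are represented as u r t with u 2\<pi>-periodic in t
  (values for r \<le> 0 are irrelevant).\<close>
definition periodic_t :: "(real \<Rightarrow> real \<Rightarrow> complex) \<Rightarrow> bool" where
  "periodic_t u \<longleftrightarrow> (\<forall>r>0. \<forall>t. u r (t + 2 * pi) = u r t)"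

definition is_solution ::
  "complex \<Rightarrow> real \<Rightarrow> (real \<Rightarrow> complex) \<Rightarrow> (real \<Rightarrow> real \<Rightarrow> complex) \<Rightarrow> bool" where
  "is_solution lam nu c u \<longleftrightarrow> periodic_t u \<and>
     (\<exists>ur ut :: real \<Rightarrow> real \<Rightarrow> complex.
        continuous_on ({0<..} \<times> UNIV) (\<lambda>(r,t). u r t) \<and>
        continuous_on ({0<..} \<times> UNIV) (\<lambda>(r,t). ur r t) \<and>
        continuous_on ({0<..} \<times> UNIV) (\<lambda>(r,t). ut r t) \<and>
        (\<forall>r>0. \<forall>t.
           ((\<lambda>s. u s t) has_vector_derivative ur r t) (at r) \<and>
           ((\<lambda>s. u r s) has_vector_derivative ut r t) (at t) \<and>
           lam * ut r t - \<i> * of_real r * ur r t + \<i> * lam * of_real nu * u r t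
             - c t * cnj (u r t) = 0))"

text \<open>w is a basic solution of L with exponent \<sigma>:
  a nontrivial solution of the form r^\<sigma> \<phi>(t) + conj (r^\<sigma> \<psi>(t)),
  \<phi>, \<psi> 2\<pi>-periodic.  (The normalisation |\<phi>| > |\<psi>| only selects \<sigma> among
  \<sigma>, conj \<sigma>, which have the same real part.)\<close>
definition basic_solution ::
  "complex \<Rightarrow> real \<Rightarrow> (real \<Rightarrow> complex) \<Rightarrow> (real \<Rightarrow> real \<Rightarrow> complex) \<Rightarrow> complex \<Rightarrow> bool" where
  "basic_solution lam nu c w \<sigma> \<longleftrightarrow>
     is_solution lam nu c w \<and> (\<exists>r>0. \<exists>t. w r t \<noteq> 0) \<and>
     (\<exists>\<phi> \<psi> :: real \<Rightarrow> complex.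
        (\<forall>t. \<phi> (t + 2 * pi) = \<phi> t) \<and> (\<forall>t. \<psi> (t + 2 * pi) = \<psi> t) \<and>
        (\<forall>r>0. \<forall>t. w r t = of_real r powr \<sigma> * \<phi> t + cnj (of_real r powr \<sigma> * \<psi> t)))"

end

theory Submission
  imports Defs
begin

text \<open>
  In the coordinate \<open>x = ln r\<close> the coefficients do not depend on \<open>x\<close>, so for a bounded solution \<open>v\<close>
  and a fixed \<open>h > 0\<close> both \<open>D(x,t) = v(x+h,t) - v(x,t)\<close> and the integral \<open>W(x,t)\<close> of
  \<open>v(\<cdot>,t)\<close> over \<open>[x,x+h]\<close> are bounded solutions, and \<open>W\<^sub>x = D\<close>.  Let \<open>J(x)\<close> be the integral of
  \<open>Re (cnj W \<cdot> D / \<lambda>)\<close> over a period in \<open>t\<close>.  Integrating by parts in \<open>t\<close>, the contributions of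
  \<open>\<nu>\<close> and \<open>c\<close> cancel and \<open>J'(x)\<close> is \<open>2 Re (1/\<lambda>)\<close> times the integral of \<open>\<bar>D\<bar>\<^sup>2\<close>.
  As \<open>W\<close> is bounded, this gives \<open>J\<^sup>2 \<le> K J'\<close>, which a bounded \<open>J\<close> on the whole line only satisfies
  if it vanishes.  Hence \<open>D = 0\<close>: bounded solutions do not depend on \<open>r\<close>, so that \<open>0\<close> is the only
  possible spectral value on the imaginary axis and \<open>u\<close> itself is a basic solution unless \<open>u = 0\<close>.
\<close>

section \<open>Energy identity and growth on the real line\<close>

text \<open>Solve the equations for \<open>Wt\<close> and \<open>Dx / lam\<close>. The
  \<open>nu\<close> terms agree on both sides because \<open>nu\<close> is real; the
  \<open>c\<close> terms \<open>\<i> * g * cnj W * cnj D\<close> and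
  \<open>- \<i> * cnj g * W * D\<close> are complex conjugates, so their real parts agree. The term
  of \<open>cnj Wt\<close> in \<open>D\<close> contributes \<open>- Re m * (norm D)\<^sup>2\<close>,
  which accounts for the factor 2.\<close>

lemma energy_density_identity:
  fixes lam W Wt D Dx Dt c :: complex and nu :: real
  assumes lam: "lam \<noteq> 0"
    and W: "lam * Wt - \<i> * D + \<i> * lam * of_real nu * W - c * cnj W = 0"
    and D: "lam * Dt - \<i> * Dx + \<i> * lam * of_real nu * D - c * cnj D = 0"
  shows "Re ((cnj D * D + cnj W * Dx) / lam)
    = 2 * Re (1 / lam) * (norm D)\<^sup>2 + Re (- \<i> * (cnj Wt * D + cnj W * Dt))"
proof -
  define g where "g = c / lam"
  define m where "m = 1 / lam"
  have Wt: "Wt = \<i> * m * D - \<i> * of_real nu * W + g * cnj W"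
    using W lam unfolding g_def m_def by (simp add: field_simps)
  have "\<i> * Dx = lam * Dt + \<i> * lam * of_real nu * D - c * cnj D"
    using D by algebra
  then have "\<i> * (\<i> * Dx) = \<i> * (lam * Dt + \<i> * lam * of_real nu * D - c * cnj D)"
    by simp
  then have "Dx = - \<i> * (lam * Dt + \<i> * lam * of_real nu * D - c * cnj D)"
    by (simp add: algebra_simps minus_equation_iff)
  then have Dx: "m * Dx = - \<i> * Dt + of_real nu * D + \<i> * g * cnj D"
    using lam unfolding g_def m_def by (simp add: field_simps)
  have "(cnj D * D + cnj W * Dx) / lam = m * (cnj D * D) + cnj W * (m * Dx)"
    by (simp add: m_def add_divide_distrib mult.commute)
  also have "Re \<dots> = 2 * Re m * (norm D)\<^sup>2 + Re (- \<i> * (cnj Wt * D + cnj W * Dt))"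
    unfolding Dx Wt cmod_power2 by (simp add: algebra_simps power2_eq_square)
  finally show ?thesis by (simp add: m_def)
qed

text \<open>A nondecreasing \<open>J\<close> that is nonzero at \<open>x\<close> stays at least as
  far from 0 on a half-line: to the right of \<open>x\<close> if positive, to the left if negative.
  There its slope is at least a fixed \<delta> > 0, contrary to boundedness. The hypothesis
  \<open>coercive\<close> is a qualitative form of \<open>J\<^sup>2 \<le> K * J'\<close>.\<close>

lemma bounded_coercive_derivative_imp_zero:
  fixes J J' :: "real \<Rightarrow> real"
  assumes der: "\<And>x. (J has_real_derivative J' x) (at x)"
    and nonneg: "\<And>x. J' x \<ge> 0"
    and bounded: "\<And>x. \<bar>J x\<bar> \<le> M"
    and coercive: "\<And>j. j > 0 \<Longrightarrow> \<exists>\<delta>>0. \<forall>x. \<bar>J x\<bar> \<ge> j \<longrightarrow> J' x \<ge> \<delta>"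
  shows "J x = 0"
proof (rule ccontr)
  assume "J x \<noteq> 0"
  then obtain \<delta> where \<delta>: "\<delta> > 0" "\<And>y. \<bar>J y\<bar> \<ge> \<bar>J x\<bar> \<Longrightarrow> J' y \<ge> \<delta>"
    using coercive[of "\<bar>J x\<bar>"] by auto
  have mono: "J y \<le> J z" if "y \<le> z" for y z
    using that by (rule DERIV_nonneg_imp_nondecreasing) (use der nonneg in blast)
  have grow: "(z - y) * \<delta> \<le> J z - J y"
    if "y < z" and "\<And>s. y < s \<Longrightarrow> s < z \<Longrightarrow> \<bar>J s\<bar> \<ge> \<bar>J x\<bar>" for y z
  proof -
    obtain s where s: "y < s" "s < z" "J z - J y = (z - y) * J' s"
      using MVT2[OF \<open>y < z\<close>, of J J'] der by blast
    then show ?thesis using \<delta>(2)[of s] that by (simp add: mult_left_mono)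
  qed
  \<comment> \<open>Over length \<open>L\<close>, slope \<delta> yields an increase of
    \<open>2 * M + 1\<close>, more than the bound \<open>M\<close> permits.\<close>
  define L where "L = (2 * M + 1) / \<delta>"
  have "M \<ge> 0" using bounded[of x] by linarith
  then have L: "L > 0" "L * \<delta> = 2 * M + 1" using \<delta>(1) by (auto simp: L_def)
  consider "J x > 0" | "J x < 0" using \<open>J x \<noteq> 0\<close> by linarith
  then show False
  proof cases
    case 1
    have "\<bar>J s\<bar> \<ge> \<bar>J x\<bar>" if "x < s" for s using mono[of x s] 1 that by linarith
    then have "L * \<delta> \<le> J (x + L) - J x" using grow[of x "x + L"] L by simp
    then show False using L bounded[of x] bounded[of "x + L"] by linarith
  next
    case 2
    have "\<bar>J s\<bar> \<ge> \<bar>J x\<bar>" if "s < x" for s using mono[of s x] 2 that by linarith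
    then have "L * \<delta> \<le> J x - J (x - L)" using grow[of "x - L" x] L by simp
    then show False using L bounded[of x] bounded[of "x - L"] by linarith
  qed
qed

lemma continuous_on_Pair_left:
  assumes "continuous_on UNIV (\<lambda>(x, t). f x t)"
  shows "continuous_on S (f x)"
  using continuous_on_compose2[OF assms, of S "Pair x"] by (simp add: continuous_intros)

section \<open>The energy method on the cylinder\<close>

text \<open>Once \<open>J\<close> vanishes identically, so does its derivative, a positive multiple
  of the integral of \<open>(norm (D x s))\<^sup>2\<close> over a period; continuity then makes
  \<open>D\<close> vanish pointwise.\<close>

lemma bounded_solution_with_bounded_primitive_eq_0:
  fixes W D Wt Dx Dt :: "real \<Rightarrow> real \<Rightarrow> complex" and lam :: complex and nu :: real
  assumes lam: "Re lam > 0"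
    and cont: "continuous_on UNIV (\<lambda>(x, t). W x t)" "continuous_on UNIV (\<lambda>(x, t). D x t)"
      "continuous_on UNIV (\<lambda>(x, t). Dx x t)"
    and Wx: "\<And>x t. ((\<lambda>x. W x t) has_vector_derivative D x t) (at x)"
    and Wt: "\<And>x t. (W x has_vector_derivative Wt x t) (at t)"
    and Dx: "\<And>x t. ((\<lambda>x. D x t) has_vector_derivative Dx x t) (at x)"
    and Dt: "\<And>x t. (D x has_vector_derivative Dt x t) (at t)"
    and per: "\<And>x t. W x (t + 2 * pi) = W x t" "\<And>x t. D x (t + 2 * pi) = D x t"
    and eqW: "\<And>x t. lam * Wt x t - \<i> * D x t + \<i> * lam * of_real nu * W x t - c t * cnj (W x t) = 0"
    and eqD: "\<And>x t. lam * Dt x t - \<i> * Dx x t + \<i> * lam * of_real nu * D x t - c t * cnj (D x t) = 0"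
    and bW: "\<And>x t. norm (W x t) \<le> BW" and bD: "\<And>x t. norm (D x t) \<le> BD"
  shows "D x t = 0"
proof -
  \<comment> \<open>The period starts at the given \<open>t\<close>, so that vanishing on
    \<open>I\<close> covers \<open>t\<close>.\<close>
  define I where "I = {t..t + 2 * pi}"
  define \<kappa> where "\<kappa> = Re (1 / lam)"
  have "lam \<noteq> 0" using lam by auto
  \<comment> \<open>\<open>Re (1 / lam)\<close> has the sign of \<open>Re lam\<close>; this makes
    \<open>J\<close> monotone.\<close>
  have "\<kappa> > 0" using lam unfolding \<kappa>_def by (simp add: Re_divide sum_power2_gt_zero_iff)
  define f where "f = (\<lambda>x s. Re (cnj (W x s) * D x s / lam))"
  define f' where "f' = (\<lambda>x s. Re ((cnj (D x s) * D x s + cnj (W x s) * Dx x s) / lam))"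
  define J where "J = (\<lambda>x. integral I (f x))"
  define e where "e = (\<lambda>x. integral I (\<lambda>s. (norm (D x s))\<^sup>2))"
  note [continuous_intros] = cont[THEN continuous_on_Pair_left]
  have contf: "continuous_on I (f x)" for x
    unfolding f_def using \<open>lam \<noteq> 0\<close> by (intro continuous_intros) auto
  have "continuous_on UNIV (\<lambda>p. Re ((cnj (D (fst p) (snd p)) * D (fst p) (snd p)
      + cnj (W (fst p) (snd p)) * Dx (fst p) (snd p)) / lam))"
    using cont \<open>lam \<noteq> 0\<close> unfolding split_beta by (intro continuous_intros) auto
  then have contf': "continuous_on (UNIV \<times> I) (\<lambda>(x, s). f' x s)"
    unfolding f'_def split_beta by (rule continuous_on_subset) simp
  have dJ: "(J has_real_derivative 2 * \<kappa> * e x) (at x)" for x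
  proof -
    have "((\<lambda>x. f x s) has_vector_derivative f' x s) (at x)" for x s
      unfolding f_def f'_def
      by (rule derivative_eq_intros bounded_linear.has_vector_derivative[OF bounded_linear_Re]
          bounded_linear.has_vector_derivative[OF bounded_linear_cnj] Wx Dx refl)+
        (simp add: algebra_simps add_divide_distrib)
    then have "(J has_real_derivative integral I (f' x)) (at x)"
      unfolding J_def I_def has_real_derivative_iff_has_vector_derivative
      using leibniz_rule_vector_derivative[of UNIV t "t + 2 * pi" f f' x]
        contf contf' by (simp add: I_def integrable_continuous_real)
    moreover have "integral I (f' x) = 2 * \<kappa> * e x"
    proof -
      \<comment> \<open>The last term of the energy identity is the \<open>t\<close>-derivative of
        \<open>g\<close>, so by periodicity it integrates to 0.\<close>
      define g where "g = (\<lambda>s. Re (- \<i> * (cnj (W x s) * D x s)))"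
      have "(g has_vector_derivative Re (- \<i> * (cnj (Wt x s) * D x s + cnj (W x s) * Dt x s))) (at s)" for s
        unfolding g_def
        by (rule derivative_eq_intros bounded_linear.has_vector_derivative[OF bounded_linear_Re]
            bounded_linear.has_vector_derivative[OF bounded_linear_cnj] Wt Dt refl)+
          (simp add: algebra_simps)
      then have "((\<lambda>s. Re (- \<i> * (cnj (Wt x s) * D x s + cnj (W x s) * Dt x s)))
          has_integral (g (t + 2 * pi) - g t)) I"
        unfolding I_def
        by (intro fundamental_theorem_of_calculus) (auto intro: has_vector_derivative_at_within)
      moreover have "g (t + 2 * pi) = g t" by (simp add: g_def per)
      moreover have "((\<lambda>s. 2 * \<kappa> * (norm (D x s))\<^sup>2) has_integral 2 * \<kappa> * e x) I"
        unfolding e_def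
        by (intro has_integral_mult_right integrable_integral)
          (auto simp: I_def intro!: integrable_continuous_real continuous_intros)
      ultimately have "((\<lambda>s. 2 * \<kappa> * (norm (D x s))\<^sup>2
            + Re (- \<i> * (cnj (Wt x s) * D x s + cnj (W x s) * Dt x s)))
          has_integral (2 * \<kappa> * e x + 0)) I"
        by (intro has_integral_add) auto
      then have "(f' x has_integral (2 * \<kappa> * e x + 0)) I"
        unfolding f'_def \<kappa>_def energy_density_identity[OF \<open>lam \<noteq> 0\<close> eqW eqD] .
      then show ?thesis by (simp add: integral_unique)
    qed
    ultimately show ?thesis by simp
  qed
  have e_nonneg: "e x \<ge> 0" for x
    unfolding e_def by (rule integral_nonneg)
      (auto simp: I_def intro!: integrable_continuous_real continuous_intros)
  \<comment> \<open>The added 1 keeps \<open>K\<close> positive even if \<open>BW = 0\<close>, since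
    \<open>K\<close> is divided by below.\<close>
  define K where "K = (BW + 1) / norm lam"
  have "BW \<ge> 0" using bW[of 0 0] norm_ge_zero[of "W 0 0"] by linarith
  then have "K > 0" using \<open>lam \<noteq> 0\<close> by (simp add: K_def)
  have bf: "\<bar>f x s\<bar> \<le> K * norm (D x s)" for x s
  proof -
    have "\<bar>f x s\<bar> \<le> norm (cnj (W x s) * D x s / lam)"
      unfolding f_def by (rule abs_Re_le_cmod)
    also have "\<dots> = norm (W x s) / norm lam * norm (D x s)"
      by (simp add: norm_mult norm_divide)
    also have "\<dots> \<le> K * norm (D x s)"
      unfolding K_def using bW[of x s] by (intro mult_right_mono divide_right_mono) auto
    finally show ?thesis .
  qed
  have bJ: "\<bar>J x\<bar> \<le> K * BD * (2 * pi)" for x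
  proof -
    have "norm (f x s) \<le> K * BD" for s
      using order_trans[OF bf mult_left_mono[OF bD]] \<open>K > 0\<close> by simp
    then show ?thesis
      using integral_bound[OF _ contf[of x, unfolded I_def], of "K * BD"]
      by (simp add: J_def I_def)
  qed
  have coercive: "\<exists>\<delta>>0. \<forall>x. \<bar>J x\<bar> \<ge> j \<longrightarrow> 2 * \<kappa> * e x \<ge> \<delta>" if "j > 0" for j
  proof (intro exI conjI allI impI)
    \<comment> \<open>Weighted AM-GM takes the place of Cauchy-Schwarz. With this \<epsilon> the
      constant term integrates to \<open>j / 2\<close> over a period, half of the lower bound for
      \<open>\<bar>J x\<bar>\<close>; the other half bounds \<open>e x\<close> from below.\<close>
    define \<epsilon> where "\<epsilon> = j / (4 * pi)"
    have "\<epsilon> > 0" using that by (simp add: \<epsilon>_def)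
    show "\<kappa> * 4 * \<epsilon> * j / K\<^sup>2 > 0" using \<open>\<kappa> > 0\<close> \<open>\<epsilon> > 0\<close> \<open>K > 0\<close> that by simp
    fix x assume j: "\<bar>J x\<bar> \<ge> j"
    have am_gm: "norm (f x s) \<le> \<epsilon> + K\<^sup>2 / (4 * \<epsilon>) * (norm (D x s))\<^sup>2" for s
    proof -
      have "0 \<le> (2 * \<epsilon> - K * norm (D x s))\<^sup>2 / (4 * \<epsilon>)" using \<open>\<epsilon> > 0\<close> by simp
      also have "\<dots> = \<epsilon> + K\<^sup>2 / (4 * \<epsilon>) * (norm (D x s))\<^sup>2 - K * norm (D x s)"
        using \<open>\<epsilon> > 0\<close> by (simp add: field_simps power2_eq_square)
      finally show ?thesis using bf[of x s] by simp
    qed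
    have "norm (J x) \<le> integral I (\<lambda>s. \<epsilon> + K\<^sup>2 / (4 * \<epsilon>) * (norm (D x s))\<^sup>2)"
      unfolding J_def using am_gm contf[of x] \<open>\<epsilon> > 0\<close>
      by (intro integral_norm_bound_integral)
        (auto simp: I_def intro!: integrable_continuous_real continuous_intros)
    also have "\<dots> = integral I (\<lambda>s. \<epsilon>) + K\<^sup>2 / (4 * \<epsilon>) * e x"
      unfolding e_def
      using \<open>\<epsilon> > 0\<close> by (subst integral_add)
        (auto simp: I_def intro!: integrable_continuous_real continuous_intros)
    also have "integral I (\<lambda>s. \<epsilon>) = j / 2" by (simp add: I_def \<epsilon>_def)
    finally have "j / 2 \<le> K\<^sup>2 / (4 * \<epsilon>) * e x" using j unfolding real_norm_def by linarith
    then have "2 * \<epsilon> * j / K\<^sup>2 \<le> e x"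
      using \<open>\<epsilon> > 0\<close> \<open>K > 0\<close> by (simp add: field_simps)
    then have "2 * \<kappa> * (2 * \<epsilon> * j / K\<^sup>2) \<le> 2 * \<kappa> * e x"
      using \<open>\<kappa> > 0\<close> by (intro mult_left_mono) auto
    then show "\<kappa> * 4 * \<epsilon> * j / K\<^sup>2 \<le> 2 * \<kappa> * e x" by (simp add: field_simps)
  qed
  have "J y = 0" for y
    by (rule bounded_coercive_derivative_imp_zero[OF dJ _ bJ coercive])
      (use \<open>\<kappa> > 0\<close> e_nonneg in auto)
  then have "J = (\<lambda>_. 0)" by blast
  then have "2 * \<kappa> * e x = 0" using dJ[of x] DERIV_const DERIV_unique by metis
  then have "integral I (\<lambda>s. (norm (D x s))\<^sup>2) = 0" using \<open>\<kappa> > 0\<close> by (simp add: e_def)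
  then have "\<forall>s\<in>I. (norm (D x s))\<^sup>2 = 0"
    unfolding I_def by (subst (asm) integral_eq_0_iff) (auto intro!: continuous_intros)
  then show ?thesis by (simp add: I_def)
qed

text \<open>Taking \<open>v\<close> and \<open>vx\<close> for \<open>W\<close> and \<open>D\<close>
  would require a second \<open>x\<close>-derivative and a bound on \<open>vx\<close>. The average
  and the difference over a fixed step \<open>h\<close> need only the first derivatives and the
  bound on \<open>v\<close>.\<close>

lemma bounded_cylinder_solution_translation_invariant:
  fixes v vx vt :: "real \<Rightarrow> real \<Rightarrow> complex" and lam :: complex and nu :: real
  assumes lam: "Re lam > 0"
    and cont: "continuous_on UNIV (\<lambda>(x, t). v x t)" "continuous_on UNIV (\<lambda>(x, t). vx x t)"
      "continuous_on UNIV (\<lambda>(x, t). vt x t)"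
    and vx: "\<And>x t. ((\<lambda>x. v x t) has_vector_derivative vx x t) (at x)"
    and vt: "\<And>x t. (v x has_vector_derivative vt x t) (at t)"
    and per: "\<And>x t. v x (t + 2 * pi) = v x t"
    and eq: "\<And>x t. lam * vt x t - \<i> * vx x t + \<i> * lam * of_real nu * v x t - c t * cnj (v x t) = 0"
    and bv: "\<And>x t. norm (v x t) \<le> B"
    and "h \<ge> 0"
  shows "v (x + h) t = v x t"
proof -
  define W where "W = (\<lambda>x t. integral {0..h} (\<lambda>y. v (x + y) t))"
  define Wt where "Wt = (\<lambda>x t. integral {0..h} (\<lambda>y. vt (x + y) t))"
  define D where "D = (\<lambda>x t. v (x + h) t - v x t)"
  define Dx where "Dx = (\<lambda>x t. vx (x + h) t - vx x t)"
  define Dt where "Dt = (\<lambda>x t. vt (x + h) t - vt x t)"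
  \<comment> \<open>Stated for arbitrary arguments \<open>a\<close> and \<open>b\<close>, so that it
    also covers translates such as \<open>v (x + y) t\<close>.\<close>
  have comp: "continuous_on S (\<lambda>p. g (a p) (b p))"
    if "continuous_on UNIV (\<lambda>(x, t). g x t)" "continuous_on S a" "continuous_on S b"
    for g :: "real \<Rightarrow> real \<Rightarrow> complex" and a b :: "'z::topological_space \<Rightarrow> real" and S
    using continuous_on_compose2[OF that(1) continuous_on_Pair[OF that(2,3)]] by simp
  note [continuous_intros] = cont[THEN comp]
  have shift: "((\<lambda>x. v (x + y) t) has_vector_derivative vx (x + y) t) (at x)" for x y t
  proof -
    have "((\<lambda>x. x + y) has_vector_derivative 1 + 0) (at x)"
      by (intro derivative_intros)
    then show ?thesis
      using vector_diff_chain_at[of "\<lambda>x. x + y" 1 x "\<lambda>x. v x t" "vx (x + y) t"] vx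
      by (simp add: o_def)
  qed
  have Wx: "((\<lambda>x. W x t) has_vector_derivative D x t) (at x)" for x t
  proof -
    have "((\<lambda>x. W x t) has_vector_derivative integral {0..h} (\<lambda>y. vx (x + y) t)) (at x)"
      unfolding W_def
      unfolding cbox_interval[symmetric]
      by (rule leibniz_rule_vector_derivative)
        (auto simp: split_beta intro!: shift integrable_continuous_real continuous_intros)
    moreover have "((\<lambda>y. vx (x + y) t) has_integral v (x + h) t - v (x + 0) t) {0..h}"
      using \<open>h \<ge> 0\<close> shift[of _ t]
      by (intro fundamental_theorem_of_calculus)
        (auto simp: add.commute[of x] intro: has_vector_derivative_at_within shift)
    ultimately show ?thesis by (simp add: D_def integral_unique)
  qed
  have "D x t = 0"
  proof (rule bounded_solution_with_bounded_primitive_eq_0[OF lam, of W D Dx Wt Dt nu c "B * h" "2 * B"])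
    have "continuous_on UNIV (\<lambda>p. integral (cbox 0 h) (\<lambda>y. v (fst p + y) (snd p)))"
      by (rule integral_continuous_on_param) (auto simp: split_beta intro!: continuous_intros)
    then show "continuous_on UNIV (\<lambda>(x, t). W x t)" by (simp add: W_def split_beta)
    show "continuous_on UNIV (\<lambda>(x, t). D x t)" "continuous_on UNIV (\<lambda>(x, t). Dx x t)"
      unfolding D_def Dx_def split_beta by (auto intro!: continuous_intros)
    fix x t
    show "((\<lambda>x. W x t) has_vector_derivative D x t) (at x)" by (rule Wx)
    show "(W x has_vector_derivative Wt x t) (at t)"
      unfolding W_def Wt_def
      unfolding cbox_interval[symmetric]
      by (rule leibniz_rule_vector_derivative)
        (auto simp: split_beta intro!: vt integrable_continuous_real continuous_intros)
    show "((\<lambda>x. D x t) has_vector_derivative Dx x t) (at x)"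
      unfolding D_def Dx_def by (intro has_vector_derivative_diff shift vx)
    show "(D x has_vector_derivative Dt x t) (at t)"
      unfolding D_def Dt_def by (intro has_vector_derivative_diff vt)
    show "W x (t + 2 * pi) = W x t" "D x (t + 2 * pi) = D x t"
      by (simp_all add: W_def D_def per)
    have "norm (D x t) \<le> norm (v (x + h) t) + norm (v x t)"
      unfolding D_def by (rule norm_triangle_ineq4)
    then show "norm (D x t) \<le> 2 * B" using bv[of "x + h" t] bv[of x t] by linarith
    show "norm (W x t) \<le> B * h"
    proof -
      have "continuous_on {0..h} (\<lambda>y. v (x + y) t)" by (intro continuous_intros)
      from integral_bound[OF \<open>h \<ge> 0\<close> this bv] show ?thesis by (simp add: W_def)
    qed
    \<comment> \<open>Subtract the equations at \<open>x + h\<close> and \<open>x\<close>: the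
      operator is additive and its coefficients do not involve \<open>x\<close>.\<close>
    show "lam * Dt x t - \<i> * Dx x t + \<i> * lam * of_real nu * D x t - c t * cnj (D x t) = 0"
      using eq[of "x + h" t] eq[of x t] unfolding D_def Dx_def Dt_def complex_cnj_diff by algebra
    have iv: "((\<lambda>y. v (x + y) t) has_integral W x t) {0..h}"
      unfolding W_def
      by (intro integrable_integral integrable_continuous_real continuous_intros)
    have ivx: "((\<lambda>y. vx (x + y) t) has_integral D x t) {0..h}"
      using fundamental_theorem_of_calculus[OF \<open>h \<ge> 0\<close>, of "\<lambda>y. v (x + y) t" "\<lambda>y. vx (x + y) t"]
        shift[of x t]
      by (auto simp: D_def add.commute[of x] intro: has_vector_derivative_at_within shift)
    have ivt: "((\<lambda>y. vt (x + y) t) has_integral Wt x t) {0..h}"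
      unfolding Wt_def
      by (intro integrable_integral integrable_continuous_real continuous_intros)
    have icnj: "((\<lambda>y. cnj (v (x + y) t)) has_integral cnj (W x t)) {0..h}"
      using iv has_integral_cnj[of "\<lambda>y. v (x + y) t"] by (simp add: o_def)
    \<comment> \<open>Integrate the equation over the translates: \<open>c t\<close> is constant in
      \<open>y\<close> and conjugation commutes with the integral. By \<open>eq\<close> the
      integrand is 0, so the value of the integral is 0.\<close>
    have "((\<lambda>y. lam * vt (x + y) t - \<i> * vx (x + y) t + \<i> * lam * of_real nu * v (x + y) t
          - c t * cnj (v (x + y) t))
        has_integral (lam * Wt x t - \<i> * D x t + \<i> * lam * of_real nu * W x t - c t * cnj (W x t))) {0..h}"
      by (intro has_integral_add has_integral_diff has_integral_mult_right iv ivx ivt icnj)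
    then show "lam * Wt x t - \<i> * D x t + \<i> * lam * of_real nu * W x t - c t * cnj (W x t) = 0"
      unfolding eq by (simp add: has_integral_0_eq)
  qed
  then show ?thesis by (simp add: D_def)
qed

section \<open>Return to the radial variable and basic solutions\<close>

lemma bounded_solution_radially_constant:
  assumes lam: "Re lam > 0" and sol: "is_solution lam nu c u"
    and bounded: "\<And>r t. r > 0 \<Longrightarrow> norm (u r t) \<le> B" and "r > 0"
  shows "u r t = u 1 t"
proof -
  obtain ur ut where
    cont: "continuous_on ({0<..} \<times> UNIV) (\<lambda>(r, t). u r t)"
      "continuous_on ({0<..} \<times> UNIV) (\<lambda>(r, t). ur r t)"
      "continuous_on ({0<..} \<times> UNIV) (\<lambda>(r, t). ut r t)"
    and ur: "\<And>r t. r > 0 \<Longrightarrow> ((\<lambda>s. u s t) has_vector_derivative ur r t) (at r)"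
    and ut: "\<And>r t. r > 0 \<Longrightarrow> (u r has_vector_derivative ut r t) (at t)"
    and eq: "\<And>r t. r > 0 \<Longrightarrow> lam * ut r t - \<i> * of_real r * ur r t
      + \<i> * lam * of_real nu * u r t - c t * cnj (u r t) = 0"
    and per: "\<And>r t. r > 0 \<Longrightarrow> u r (t + 2 * pi) = u r t"
    using sol unfolding is_solution_def periodic_t_def by auto
  \<comment> \<open>By the chain rule this is the \<open>x\<close>-derivative of
    \<open>u (exp x) t\<close>; it absorbs the factor \<open>r\<close> in front of
    \<open>ur\<close>.\<close>
  define vx where "vx = (\<lambda>x t. of_real (exp x) * ur (exp x) t)"
  have exp: "continuous_on UNIV (\<lambda>p. g (exp (fst p)) (snd p))"
    if "continuous_on ({0<..} \<times> UNIV) (\<lambda>(r, t). g r t)" for g :: "real \<Rightarrow> real \<Rightarrow> complex"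
  proof -
    have "continuous_on UNIV (\<lambda>p. (exp (fst p), snd p) :: real \<times> real)"
      by (intro continuous_intros)
    from continuous_on_compose2[OF that this] show ?thesis by (simp add: image_subset_iff)
  qed
  have shift: "u (exp (x + h)) t = u (exp x) t" if "h \<ge> 0" for x h t
  proof (rule bounded_cylinder_solution_translation_invariant
      [OF lam, of "\<lambda>x. u (exp x)" vx "\<lambda>x. ut (exp x)" nu c B])
    show "continuous_on UNIV (\<lambda>(x, t). u (exp x) t)" "continuous_on UNIV (\<lambda>(x, t). vx x t)"
      "continuous_on UNIV (\<lambda>(x, t). ut (exp x) t)"
      using cont[THEN exp] unfolding vx_def split_beta by (auto intro!: continuous_intros)
    fix x t
    show "((\<lambda>x. u (exp x) t) has_vector_derivative vx x t) (at x)"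
      using vector_diff_chain_at[of exp "exp x" x "\<lambda>r. u r t" "ur (exp x) t"] ur[of "exp x" t]
        DERIV_exp[of x]
      by (simp add: o_def vx_def has_real_derivative_iff_has_vector_derivative scaleR_conv_of_real)
    show "lam * ut (exp x) t - \<i> * vx x t + \<i> * lam * of_real nu * u (exp x) t
        - c t * cnj (u (exp x) t) = 0"
      using eq[of "exp x" t] by (simp add: vx_def mult.assoc)
  qed (use ut per bounded that in auto)
  show ?thesis
  proof (cases "r \<ge> 1")
    case True
    then show ?thesis using shift[of "ln r" 0 t] \<open>r > 0\<close> by simp
  next
    case False
    \<comment> \<open>Shifts are nonnegative, so for \<open>r < 1\<close> the base point is
      \<open>ln r\<close> and the shift leads up to 0.\<close>
    then show ?thesis using shift[of "- ln r" "ln r" t] \<open>r > 0\<close> by simp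
  qed
qed

theorem theorem6p8:
  fixes a b nu :: real and k :: nat and c :: "real \<Rightarrow> complex"
    and u :: "real \<Rightarrow> real \<Rightarrow> complex"
  assumes "a > 0" and "b \<noteq> 0" and "0 \<le> nu" and "nu < 1" and "k \<ge> 2"
    and "Ck k c" and "\<forall>t. c (t + 2 * pi) = c t"
    and "is_solution (Complex a b) nu c u"
    and "\<exists>B. \<forall>r>0. \<forall>t. norm (u r t) \<le> B"
  shows "(\<exists>(n::nat) (w :: nat \<Rightarrow> real \<Rightarrow> real \<Rightarrow> complex) (coef :: nat \<Rightarrow> real).
            (\<forall>i<n. \<exists>\<sigma>. basic_solution (Complex a b) nu c (w i) \<sigma> \<and> Re \<sigma> = 0) \<and>
            (\<forall>r>0. \<forall>t. u r t = (\<Sum>i<n. of_real (coef i) * w i r t)))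
       \<and> ((\<nexists>w \<sigma>. basic_solution (Complex a b) nu c w \<sigma> \<and> Re \<sigma> = 0)
            \<longrightarrow> (\<forall>r>0. \<forall>t. u r t = 0))"
proof (cases "\<forall>r>0. \<forall>t. u r t = 0")
  case True
  \<comment> \<open>The zero solution is the empty sum, \<open>n = 0\<close>.\<close>
  then show ?thesis by (auto intro!: exI[of _ "0::nat"])
next
  case False
  have const: "u r t = u 1 t" if "r > 0" for r t
    using bounded_solution_radially_constant[of "Complex a b" nu c u _ r t] assms that by auto
  have basic: "basic_solution (Complex a b) nu c u 0"
    unfolding basic_solution_def
  proof (intro conjI)
    show "is_solution (Complex a b) nu c u" by fact
    show "\<exists>r>0. \<exists>t. u r t \<noteq> 0" using False by blast
    have "\<forall>t. u 1 (t + 2 * pi) = u 1 t"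
      using assms(8) unfolding is_solution_def periodic_t_def by simp
    \<comment> \<open>Exponent 0 with \<phi> = \<open>u 1\<close> and \<psi> = 0; the power equals 1
      because \<open>r\<close> is nonzero.\<close>
    moreover have "\<forall>r>0. \<forall>t. u r t = of_real r powr 0 * u 1 t + cnj (of_real r powr 0 * 0)"
    proof (intro allI impI)
      fix r t :: real assume "r > 0"
      then show "u r t = of_real r powr 0 * u 1 t + cnj (of_real r powr 0 * 0)"
        using const[of r t] by simp
    qed
    ultimately show "\<exists>\<phi> \<psi>. (\<forall>t. \<phi> (t + 2 * pi) = \<phi> t) \<and> (\<forall>t. \<psi> (t + 2 * pi) = \<psi> t) \<and>
        (\<forall>r>0. \<forall>t. u r t = of_real r powr 0 * \<phi> t + cnj (of_real r powr 0 * \<psi> t))"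
      by (rule_tac x = "u 1" in exI, rule_tac x = "\<lambda>_. 0" in exI) blast
  qed
  \<comment> \<open>A single term with coefficient 1 suffices: \<open>u\<close> is its own basic
    solution.\<close>
  have "(\<forall>i<1::nat. \<exists>\<sigma>. basic_solution (Complex a b) nu c u \<sigma> \<and> Re \<sigma> = 0) \<and>
      (\<forall>r>0. \<forall>t. u r t = (\<Sum>i<1::nat. of_real 1 * u r t))"
    using basic zero_complex.sel(1) by auto
  then have "\<exists>(n::nat) (w :: nat \<Rightarrow> real \<Rightarrow> real \<Rightarrow> complex) (coef :: nat \<Rightarrow> real).
      (\<forall>i<n. \<exists>\<sigma>. basic_solution (Complex a b) nu c (w i) \<sigma> \<and> Re \<sigma> = 0) \<and>
      (\<forall>r>0. \<forall>t. u r t = (\<Sum>i<n. of_real (coef i) * w i r t))"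
    by (intro exI)
  \<comment> \<open>A nonzero \<open>u\<close> provides an imaginary spectral value itself, so the
    premise of the second claim fails.\<close>
  moreover have "\<exists>w \<sigma>. basic_solution (Complex a b) nu c w \<sigma> \<and> Re \<sigma> = 0"
    using basic zero_complex.sel(1) by blast
  ultimately show ?thesis by blast
qed

end
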